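(* Let the errors $\varepsilon_i$ be Gaussian with zero mean. Consider the problem of estimating the linear functional $\phi^*=\mathcal Kf^*$ by a given family $\tilde\phi_m=\mathcal K_mY$ with $\mathrm{rank}(\mathcal K_m)=\mathrm{rank}(\mathcal K)=1$, $m\in\mathcal M$. Then the critical values $\mathfrak z_{m,m^\circ}=z_{m,m^\circ}(x+q_{m^\circ})+\beta\sqrt{\mathsf p_{m,m^\circ}}$ fulfill, for all $m>m^\circ$ in $\mathcal M$, $$\mathfrak z_{m,m^\circ}\le\mathrm v_{m,m^\circ}\Bigl(\beta+\sqrt{2x+2\log(|\mathcal M|)}\Bigr),$$ and the oracle inequality $$|\hat\phi-\phi^*|\le|\tilde\phi_{m^*}-\phi^*|+\bar{\mathfrak z}_{m^*}$$ holds with probability at least $1-2e^{-x}$ for the SmA ("smallest accepted") estimator $\hat\phi=\tilde\phi_{\hat m}$, with the payment for adaptation $\bar{\mathfrak z}_{m^*}$ obeying $$\bar{\mathfrak z}_{m^*}\le\mathrm v_{m^*}\Bigl(\beta+\sqrt{2x+2\log(|\mathcal M|)}\Bigr).$$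
   Context: Model: $Y=f^*+\varepsilon\in\mathbb R^n$, $f^*=\mathbb EY$ deterministic, $\varepsilon=(\varepsilon_i)$ with independent zero-mean components and known distribution. $\mathcal M$ is a finite set of positive numbers with cardinality $|\mathcal M|$; $\mathcal K$ and $\mathcal K_m$, $m\in\mathcal M$, are linear functionals ($1\times n$ matrices). The tuning constants $x>0$ and $\beta\ge0$ are given. Variances: $\mathrm v_m^2=\mathrm{Var}(\mathcal K_mY)=\mathcal K_m\mathrm{Var}(\varepsilon)\mathcal K_m^\top$, assumed to grow with $m$ (ordering condition). For $m>m^\circ$ in $\mathcal M$: $\mathcal K_{m,m^\circ}=\mathcal K_m-\mathcal K_{m^\circ}$, $\xi_{m,m^\circ}=\mathcal K_{m,m^\circ}\varepsilon$, $b_{m,m^\circ}=\mathcal K_{m,m^\circ}f^*$, $\mathsf p_{m,m^\circ}=\mathrm v_{m,m^\circ}^2=\mathrm{Var}(\xi_{m,m^\circ})=\mathcal K_{m,m^\circ}\mathrm{Var}(\varepsilon)\mathcal K_{m,m^\circ}^\top$, $\mathbb T_{m,m^\circ}=|\tilde\phi_m-\tilde\phi_{m^\circ}|$. $\mathcal M^+(m^\circ)=\{m\in\mathcal M:m>m^\circ\}$, $\mathcal M^-(m^\circ)=\{m\in\mathcal M:m<m^\circ\}$. Oracle: $m^*$ is the smallest $m^\circ\in\mathcal M$ such that $|b_{m,m^\circ}|^2\le\beta^2\mathsf p_{m,m^\circ}$ for all $m\in\mathcal M^+(m^\circ)$. Tail function: $\mathbb P(|\xi_{m,m^\circ}|>z_{m,m^\circ}(t))=e^{-t}$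 (if the distribution of $|\xi_{m,m^\circ}|$ is not continuous, $z_{m,m^\circ}(t)$ is the smallest value for which this probability is at most $e^{-t}$). Multiplicity correction: $q_{m^\circ}=q_{m^\circ}(x)$ is defined by $\mathbb P\bigl(\bigcup_{m\in\mathcal M^+(m^\circ)}\{|\xi_{m,m^\circ}|\ge z_{m,m^\circ}(x+q_{m^\circ})\}\bigr)=e^{-x}$. SmA selector: $m^\circ$ is accepted if $\mathbb T_{m,m^\circ}\le\mathfrak z_{m,m^\circ}$ for all $m\in\mathcal M^+(m^\circ)$, and $\hat m$ is the smallest accepted element of $\mathcal M$. Payment for adaptation: let $\mathcal M^c\subseteq\mathcal M^-(m^* )$ be any subset such that $|b_{m^*,m}|>\mathfrak z_{m^*,m}+z_{m^*,m}(x_s)$ for all $m\in\mathcal M^c$, with $x_s=x+\log(|\mathcal M^c|)$ (the condition is void if $\mathcal M^c=\emptyset$), and $\bar{\mathfrak z}_{m^*}=\max_{m\in\mathcal M^-(m^* )\setminus\mathcal M^c}\mathfrak z_{m^*,m}$ (read as zero if the set is empty).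
   Formalization: The final bound on the payment for adaptation is proved under the added condition that v_{m*,m} ≤ v_{m*} for all m < m* outside M^c; growth of v_m alone does not suffice (n=1, K_1=-0.99, K_2=1, |f*|>β, β large). *)

theory Defs
  imports "HOL-Probability.Probability"
begin

text \<open>
  Data: a probability space \<open>P\<close>, the noise \<open>eps\<close> (a random vector in \<open>real ^ 'n\<close>), the deterministic
  signal \<open>f\<close>, so that \<open>Y = f + eps\<close>, a finite set \<open>Ms\<close> of positive reals and a family \<open>K m\<close> of
  \<open>1 \<times> n\<close> matrices. In a pair of indices \<open>m m0\<close> the larger one comes first.
\<close>

definition functional :: "real ^ 'n ^ 1 \<Rightarrow> real ^ 'n \<Rightarrow> real" where
  "functional A y = (A *v y) $ 1"

text \<open>A Gaussian law \<open>N(0, \<sigma>\<^sup>2)\<close>; the second disjunct is the degenerate case \<open>\<sigma> = 0\<close>.\<close>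

definition centered_gaussian :: "'a measure \<Rightarrow> ('a \<Rightarrow> real) \<Rightarrow> bool" where
  "centered_gaussian P X \<longleftrightarrow>
     (\<exists>\<sigma>>0. distributed P lborel X (normal_density 0 \<sigma>)) \<or>
     (X \<in> borel_measurable P \<and> (AE \<omega> in P. X \<omega> = 0))"

text \<open>\<open>v\<^sub>m = sqrt (Var (K\<^sub>m Y))\<close>\<close>

definition est_sd ::
  "'a measure \<Rightarrow> ('a \<Rightarrow> real ^ 'n) \<Rightarrow> real ^ 'n \<Rightarrow> (real \<Rightarrow> real ^ 'n ^ 1) \<Rightarrow> real \<Rightarrow> real" where
  "est_sd P eps f K m = sqrt (prob_space.variance P (\<lambda>\<omega>. functional (K m) (f + eps \<omega>)))"

definition xi :: "('a \<Rightarrow> real ^ 'n) \<Rightarrow> (real \<Rightarrow> real ^ 'n ^ 1) \<Rightarrow> real \<Rightarrow> real \<Rightarrow> 'a \<Rightarrow> real" where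
  "xi eps K m m0 \<omega> = functional (K m - K m0) (eps \<omega>)"

definition bias :: "real ^ 'n \<Rightarrow> (real \<Rightarrow> real ^ 'n ^ 1) \<Rightarrow> real \<Rightarrow> real \<Rightarrow> real" where
  "bias f K m m0 = functional (K m - K m0) f"

text \<open>\<open>p\<^sub>m\<^sub>,\<^sub>m\<^sub>0\<close> and its square root \<open>v\<^sub>m\<^sub>,\<^sub>m\<^sub>0\<close>\<close>

definition diff_var ::
  "'a measure \<Rightarrow> ('a \<Rightarrow> real ^ 'n) \<Rightarrow> (real \<Rightarrow> real ^ 'n ^ 1) \<Rightarrow> real \<Rightarrow> real \<Rightarrow> real" where
  "diff_var P eps K m m0 = prob_space.variance P (xi eps K m m0)"

definition diff_sd ::
  "'a measure \<Rightarrow> ('a \<Rightarrow> real ^ 'n) \<Rightarrow> (real \<Rightarrow> real ^ 'n ^ 1) \<Rightarrow> real \<Rightarrow> real \<Rightarrow> real" where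
  "diff_sd P eps K m m0 = sqrt (diff_var P eps K m m0)"

definition M_plus :: "real set \<Rightarrow> real \<Rightarrow> real set" where
  "M_plus Ms m0 = {m \<in> Ms. m0 < m}"

definition M_minus :: "real set \<Rightarrow> real \<Rightarrow> real set" where
  "M_minus Ms m0 = {m \<in> Ms. m < m0}"

definition oracle_index ::
  "'a measure \<Rightarrow> ('a \<Rightarrow> real ^ 'n) \<Rightarrow> real ^ 'n \<Rightarrow> (real \<Rightarrow> real ^ 'n ^ 1) \<Rightarrow> real set \<Rightarrow> real \<Rightarrow> real" where
  "oracle_index P eps f K Ms \<beta> =
     Min {m0 \<in> Ms. \<forall>m \<in> M_plus Ms m0. \<bar>bias f K m m0\<bar>\<^sup>2 \<le> \<beta>\<^sup>2 * diff_var P eps K m m0}"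

text \<open>
  The tail function. The minimum over \<open>z \<ge> 0\<close> is always attained (the tail is right-continuous), and
  for a continuous law of \<open>\<bar>xi\<bar>\<close> and \<open>t \<ge> 0\<close> the probability at the minimum equals \<open>exp (- t)\<close>.
\<close>

definition tail_fun ::
  "'a measure \<Rightarrow> ('a \<Rightarrow> real ^ 'n) \<Rightarrow> (real \<Rightarrow> real ^ 'n ^ 1) \<Rightarrow> real \<Rightarrow> real \<Rightarrow> real \<Rightarrow> real" where
  "tail_fun P eps K m m0 t =
     (LEAST z. 0 \<le> z \<and> measure P {\<omega> \<in> space P. \<bar>xi eps K m m0 \<omega>\<bar> > z} \<le> exp (- t))"

text \<open>
  The equation defining the multiplicity correction \<open>q\<close>. For the largest element of \<open>Ms\<close> the union is
  empty and the equation unsolvable, but \<open>q\<close> is not used there.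
\<close>

definition multiplicity_correction ::
  "'a measure \<Rightarrow> ('a \<Rightarrow> real ^ 'n) \<Rightarrow> (real \<Rightarrow> real ^ 'n ^ 1) \<Rightarrow> real set \<Rightarrow> real \<Rightarrow> (real \<Rightarrow> real) \<Rightarrow> bool" where
  "multiplicity_correction P eps K Ms x q \<longleftrightarrow>
     (\<forall>m0 \<in> Ms. M_plus Ms m0 \<noteq> {} \<longrightarrow>
        measure P (\<Union>m \<in> M_plus Ms m0.
          {\<omega> \<in> space P. \<bar>xi eps K m m0 \<omega>\<bar> \<ge> tail_fun P eps K m m0 (x + q m0)}) = exp (- x))"

definition critical_value ::
  "'a measure \<Rightarrow> ('a \<Rightarrow> real ^ 'n) \<Rightarrow> (real \<Rightarrow> real ^ 'n ^ 1) \<Rightarrow> real \<Rightarrow> real \<Rightarrow> (real \<Rightarrow> real)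
     \<Rightarrow> real \<Rightarrow> real \<Rightarrow> real" where
  "critical_value P eps K x \<beta> q m m0 =
     tail_fun P eps K m m0 (x + q m0) + \<beta> * sqrt (diff_var P eps K m m0)"

definition accepted ::
  "(real \<Rightarrow> real ^ 'n ^ 1) \<Rightarrow> real set \<Rightarrow> (real \<Rightarrow> real \<Rightarrow> real) \<Rightarrow> real ^ 'n \<Rightarrow> real \<Rightarrow> bool" where
  "accepted K Ms zc y m0 \<longleftrightarrow>
     (\<forall>m \<in> M_plus Ms m0. \<bar>functional (K m) y - functional (K m0) y\<bar> \<le> zc m m0)"

definition sma_selector ::
  "(real \<Rightarrow> real ^ 'n ^ 1) \<Rightarrow> real set \<Rightarrow> (real \<Rightarrow> real \<Rightarrow> real) \<Rightarrow> real ^ 'n \<Rightarrow> real" where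
  "sma_selector K Ms zc y = Min {m0 \<in> Ms. accepted K Ms zc y m0}"

definition payment :: "real set \<Rightarrow> real set \<Rightarrow> (real \<Rightarrow> real \<Rightarrow> real) \<Rightarrow> real \<Rightarrow> real" where
  "payment Ms Mc zc ms =
     (if M_minus Ms ms - Mc = {} then 0 else Max ((\<lambda>m. zc ms m) ` (M_minus Ms ms - Mc)))"

text \<open>
  Comparison of the variance of an increment \<open>K\<^sub>m\<^sub>s Y - K\<^sub>m Y\<close> with that of \<open>K\<^sub>m\<^sub>s Y\<close>. It holds for instance for
  nested projection estimators with homogeneous noise, but not for every family with increasing
  variances: with \<open>n = 1\<close>, standard normal noise, \<open>Ms = {1, 2}\<close>, \<open>K 1 = - 0.99\<close> and \<open>K 2 = 1\<close> the standard
  deviation of the increment is \<open>1.99\<close>. For large \<open>f\<close> and \<open>Mc = {}\<close> the payment for adaptation is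
  then at least \<open>1.99 * \<beta>\<close>, which for large \<open>\<beta>\<close> exceeds \<open>\<beta> + sqrt (2 * x + 2 * ln 2)\<close>.
\<close>

definition increments_dominated ::
  "'a measure \<Rightarrow> ('a \<Rightarrow> real ^ 'n) \<Rightarrow> real ^ 'n \<Rightarrow> (real \<Rightarrow> real ^ 'n ^ 1) \<Rightarrow> real set \<Rightarrow> real \<Rightarrow> bool" where
  "increments_dominated P eps f K S ms \<longleftrightarrow> (\<forall>m \<in> S. diff_sd P eps K ms m \<le> est_sd P eps f K ms)"

end

theory Submission
  imports Defs
begin

text \<open>
  The argument has a probabilistic and a deterministic half.

  Probabilistic half. Each \<open>\<xi>\<^sub>m\<^sub>,\<^sub>m\<^sub>0\<close> is a linear combination of independent centred Gaussians, hence
  centred Gaussian (\<open>centered_gaussian_linear_combination\<close>), and satisfies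
  \<open>P(\<bar>\<xi>\<bar> > v sqrt (2t)) \<le> exp (-t)\<close>, where \<open>v\<close> is its standard deviation (\<open>centered_gaussian_tail\<close>).
  So its tail function at \<open>t\<close> is at most \<open>v sqrt (2t)\<close>. The level \<open>t = x + q\<close> is controlled by the
  union bound: the union in the definition of \<open>q\<close> has probability \<open>exp (-x)\<close>, while each of its
  members has probability at most \<open>exp (-t)\<close>; so \<open>t\<close> is at most \<open>x + ln (card Ms)\<close>
  (\<open>union_of_tails_level\<close>). This gives the bound on the critical values, and also the one on the
  payment, a maximum of critical values whose \<open>v\<close> is dominated by the standard deviation at \<open>ms\<close>.

  Deterministic half. Suppose that the index \<open>ms\<close> is accepted and that no element of \<open>Mc\<close> is. Then the
  selected index is either \<open>ms\<close> or a smaller accepted index outside \<open>Mc\<close>; in the second case its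
  acceptance includes the comparison with \<open>ms\<close>, so the two estimates differ by at most a critical value
  that enters the payment (\<open>sma_selector_close\<close>). The triangle inequality finishes.

  Two events of probability at most \<open>exp (-x)\<close> remain to be excluded. If \<open>ms\<close> is rejected, then, its
  biases being at most \<open>\<beta> v\<close>, some \<open>\<xi>\<close> exceeds its quantile at level \<open>x + q ms\<close>, an event of
  probability at most \<open>exp (-x)\<close> by the choice of \<open>q\<close>. If some \<open>m \<in> Mc\<close> is accepted, then the noise must
  have compensated the large bias and \<open>\<bar>\<xi>\<^sub>m\<^sub>s\<^sub>,\<^sub>m\<bar>\<close> exceeds its quantile at level \<open>xs\<close>; summing
  \<open>exp (-xs)\<close> over the elements of \<open>Mc\<close> gives \<open>exp (-x)\<close> again.
\<close>

section \<open>Centred Gaussian variables\<close>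

lemma (in prob_space) distributed_cong_AE:
  assumes "distributed M N X g" "Y \<in> measurable M N" "AE \<omega> in M. Y \<omega> = X \<omega>"
  shows "distributed M N Y g"
proof -
  have "distr M N Y = distr M N X"
    using assms by (intro distr_cong_AE) (auto simp: distributed_def)
  then show ?thesis
    using assms by (simp add: distributed_def)
qed

text \<open>
  The convolution theorem for normal densities needs positive variances and a nonempty sum. The terms
  with zero coefficient or degenerate law vanish almost surely, so the sum agrees almost surely with the
  one over the remaining terms, and is itself degenerate if no term remains.
\<close>

lemma (in prob_space) centered_gaussian_linear_combination:
  fixes X :: "'i \<Rightarrow> 'a \<Rightarrow> real" and c :: "'i \<Rightarrow> real"
  assumes I: "finite I" and indep: "indep_vars (\<lambda>_. borel) X I"
    and gauss: "\<And>i. i \<in> I \<Longrightarrow> centered_gaussian M (X i)"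
  shows "centered_gaussian M (\<lambda>\<omega>. \<Sum>i\<in>I. c i * X i \<omega>)"
proof -
  define J where "J = {i \<in> I. c i \<noteq> 0 \<and> (\<exists>\<sigma>>0. distributed M lborel (X i) (normal_density 0 \<sigma>))}"
  have J: "J \<subseteq> I" "finite J" using I by (auto simp: J_def)
  have rv: "X i \<in> borel_measurable M" if "i \<in> I" for i
    using gauss[OF that] by (auto simp: centered_gaussian_def distributed_def)
  have rv_sum: "(\<lambda>\<omega>. \<Sum>i\<in>I. c i * X i \<omega>) \<in> borel_measurable M"
    using rv by measurable
  have null: "AE \<omega> in M. c i * X i \<omega> = 0" if "i \<in> I - J" for i
    using that gauss[of i] by (cases "c i = 0") (auto simp: J_def centered_gaussian_def)
  have "AE \<omega> in M. \<forall>i\<in>I - J. c i * X i \<omega> = 0"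
    using I null by (subst AE_finite_all) auto
  then have eq: "AE \<omega> in M. (\<Sum>i\<in>I. c i * X i \<omega>) = (\<Sum>i\<in>J. c i * X i \<omega>)"
  proof eventually_elim
    case (elim \<omega>)
    then show ?case
      using I J by (intro sum.mono_neutral_right) auto
  qed
  show ?thesis
  proof (cases "J = {}")
    case True
    then show ?thesis using eq rv_sum by (simp add: centered_gaussian_def)
  next
    case False
    have "\<forall>i\<in>J. \<exists>\<sigma>>0. distributed M lborel (X i) (normal_density 0 \<sigma>)"
      by (auto simp: J_def)
    then obtain \<sigma> where \<sigma>: "\<And>i. i \<in> J \<Longrightarrow> 0 < \<sigma> i"
        "\<And>i. i \<in> J \<Longrightarrow> distributed M lborel (X i) (normal_density 0 (\<sigma> i))"
      by metis
    have scaled: "distributed M lborel (\<lambda>\<omega>. c i * X i \<omega>) (normal_density 0 (\<bar>c i\<bar> * \<sigma> i))"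
      if "i \<in> J" for i
      using normal_density_affine[OF \<sigma>(2)[OF that] \<sigma>(1)[OF that], of "c i" 0] that
      by (auto simp: J_def)
    have "indep_vars (\<lambda>_. borel) (\<lambda>i \<omega>. c i * X i \<omega>) J"
      using indep_vars_compose2[OF indep_vars_subset[OF indep J(1)], of "\<lambda>i y. c i * y" "\<lambda>_. borel"]
      by simp
    then have "distributed M lborel (\<lambda>\<omega>. \<Sum>i\<in>J. c i * X i \<omega>)
        (normal_density (\<Sum>i\<in>J. 0) (sqrt (\<Sum>i\<in>J. (\<bar>c i\<bar> * \<sigma> i)\<^sup>2)))"
      using scaled \<sigma>(1) by (intro sum_indep_normal[OF J(2) False]) (auto simp: J_def)
    then have "distributed M lborel (\<lambda>\<omega>. \<Sum>i\<in>I. c i * X i \<omega>)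
        (normal_density 0 (sqrt (\<Sum>i\<in>J. (\<bar>c i\<bar> * \<sigma> i)\<^sup>2)))"
      using distributed_cong_AE[where N = lborel, OF _ _ eq] rv_sum by simp
    moreover have "0 < sqrt (\<Sum>i\<in>J. (\<bar>c i\<bar> * \<sigma> i)\<^sup>2)"
    proof -
      have "0 < (\<bar>c i\<bar> * \<sigma> i)\<^sup>2" if "i \<in> J" for i
        using that \<sigma>(1)[OF that] by (simp add: J_def)
      then show ?thesis
        using sum_pos[OF J(2) False, of "\<lambda>i. (\<bar>c i\<bar> * \<sigma> i)\<^sup>2"] by simp
    qed
    ultimately show ?thesis
      unfolding centered_gaussian_def by blast
  qed
qed

text \<open>
  Expanding the square, \<open>(z + u)\<^sup>2 \<ge> z\<^sup>2 + u\<^sup>2\<close> when \<open>z\<close> and \<open>u\<close> do not have opposite signs.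
\<close>

lemma normal_density_shift_le:
  assumes "0 < \<sigma>" "0 \<le> z * u"
  shows "normal_density 0 \<sigma> (z + u) \<le> exp (- z\<^sup>2 / (2 * \<sigma>\<^sup>2)) * normal_density 0 \<sigma> u"
proof -
  have "- (z + u)\<^sup>2 / (2 * \<sigma>\<^sup>2) \<le> - z\<^sup>2 / (2 * \<sigma>\<^sup>2) + - u\<^sup>2 / (2 * \<sigma>\<^sup>2)"
    using assms by (simp add: power2_sum add_divide_distrib diff_divide_distrib)
  then have "exp (- (z + u)\<^sup>2 / (2 * \<sigma>\<^sup>2)) \<le> exp (- z\<^sup>2 / (2 * \<sigma>\<^sup>2)) * exp (- u\<^sup>2 / (2 * \<sigma>\<^sup>2))"
    by (simp flip: exp_add)
  then have "1 / sqrt (2 * pi * \<sigma>\<^sup>2) * exp (- (z + u)\<^sup>2 / (2 * \<sigma>\<^sup>2))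
      \<le> 1 / sqrt (2 * pi * \<sigma>\<^sup>2) * (exp (- z\<^sup>2 / (2 * \<sigma>\<^sup>2)) * exp (- u\<^sup>2 / (2 * \<sigma>\<^sup>2)))"
    by (intro mult_left_mono) auto
  then show ?thesis
    by (simp add: normal_density_def mult_ac)
qed

text \<open>
  Shift each of the two tails to the origin. By the preceding lemma the shifted densities are at most
  \<open>exp (- z\<^sup>2 / (2\<sigma>\<^sup>2))\<close> times the original density, and the two half-lines together carry mass one. This
  has constant 1 in front of the exponential; the factor 2 of Chernoff bounds on both sides
  would show up in the critical values.
\<close>

lemma (in prob_space) normal_two_sided_tail:
  assumes X: "distributed M lborel X (normal_density 0 \<sigma>)" and \<sigma>: "0 < \<sigma>" and z: "0 \<le> z"
  shows "prob {\<omega> \<in> space M. z < \<bar>X \<omega>\<bar>} \<le> exp (- z\<^sup>2 / (2 * \<sigma>\<^sup>2))"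
proof -
  let ?g = "normal_density 0 \<sigma>" and ?e = "exp (- z\<^sup>2 / (2 * \<sigma>\<^sup>2))"
  have split: "ennreal (?g u) * indicator {u. z < \<bar>u\<bar>} u
      = ennreal (?g u) * indicator {z<..} u + ennreal (?g u) * indicator {..<- z} u" for u
    using z by (auto split: split_indicator)
  have upper: "(\<integral>\<^sup>+u. ennreal (?g u) * indicator {z<..} u \<partial>lborel)
      = (\<integral>\<^sup>+u. ennreal (?g (z + u)) * indicator {0<..} u \<partial>lborel)"
    by (subst nn_integral_real_affine[where c=1 and t=z])
       (auto intro!: nn_integral_cong split: split_indicator)
  have lower: "(\<integral>\<^sup>+u. ennreal (?g u) * indicator {..<- z} u \<partial>lborel)
      = (\<integral>\<^sup>+u. ennreal (?g (- z + u)) * indicator {..<0} u \<partial>lborel)"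
    by (subst nn_integral_real_affine[where c=1 and t="- z"])
       (auto intro!: nn_integral_cong split: split_indicator)
  have "emeasure M {\<omega> \<in> space M. z < \<bar>X \<omega>\<bar>} = emeasure M (X -` {u. z < \<bar>u\<bar>} \<inter> space M)"
    by (intro arg_cong[where f = "emeasure M"]) auto
  also have "\<dots> = (\<integral>\<^sup>+u. ennreal (?g u) * indicator {u. z < \<bar>u\<bar>} u \<partial>lborel)"
    by (rule distributed_emeasure[OF X]) simp
  also have "\<dots> = (\<integral>\<^sup>+u. ennreal (?g (z + u)) * indicator {0<..} u
        + ennreal (?g (- z + u)) * indicator {..<0} u \<partial>lborel)"
    unfolding split by (simp add: nn_integral_add upper lower)
  also have "\<dots> \<le> (\<integral>\<^sup>+u. ennreal (?e * ?g u) \<partial>lborel)"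
    using normal_density_shift_le[OF \<sigma>, of z] normal_density_shift_le[OF \<sigma>, of "- z"] z
    by (intro nn_integral_mono)
       (auto split: split_indicator intro!: ennreal_leI simp: mult_nonneg_nonpos)
  also have "\<dots> = ennreal ?e"
    using \<sigma> by (subst nn_integral_eq_integral) auto
  finally show ?thesis
    by (simp add: emeasure_eq_measure)
qed

text \<open>
  The tail function is defined with a strict inequality, the multiplicity correction with a weak one; the
  absence of atoms reconciles them.
\<close>

lemma (in prob_space) normal_abs_no_atom:
  assumes X: "distributed M lborel X (normal_density 0 \<sigma>)"
  shows "prob {\<omega> \<in> space M. z \<le> \<bar>X \<omega>\<bar>} = prob {\<omega> \<in> space M. z < \<bar>X \<omega>\<bar>}"
proof -
  have [measurable]: "X \<in> borel_measurable M"
    using X by (simp add: distributed_def)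
  have "emeasure M (X -` {z, - z} \<inter> space M)
      = (\<integral>\<^sup>+u. ennreal (normal_density 0 \<sigma> u) * indicator {z, - z} u \<partial>lborel)"
    by (rule distributed_emeasure[OF X]) simp
  also have "\<dots> = (\<integral>\<^sup>+u. 0 \<partial>(lborel :: real measure))"
  proof (rule nn_integral_cong_AE)
    show "AE u in lborel. ennreal (normal_density 0 \<sigma> u) * indicator {z, - z} u = 0"
      using AE_lborel_singleton[of z] AE_lborel_singleton[of "- z"]
      by eventually_elim simp
  qed
  finally have "X -` {z, - z} \<inter> space M \<in> null_sets M"
    by auto
  then have "AE \<omega> in M. \<omega> \<notin> X -` {z, - z} \<inter> space M"
    by (rule AE_not_in)
  then show ?thesis
    by (intro finite_measure_eq_AE) auto
qed

lemma (in prob_space) centered_gaussian_tail: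
  assumes X: "centered_gaussian M X" and t: "0 \<le> t"
  shows "prob {\<omega> \<in> space M. sqrt (variance X) * sqrt (2 * t) < \<bar>X \<omega>\<bar>} \<le> exp (- t)"
  using X unfolding centered_gaussian_def
proof (elim disjE exE conjE)
  fix \<sigma> :: real assume \<sigma>: "0 < \<sigma>" and D: "distributed M lborel X (normal_density 0 \<sigma>)"
  have "sqrt (variance X) = \<sigma>"
    using normal_distributed_variance[OF \<sigma> D] \<sigma> by simp
  then show ?thesis
    using normal_two_sided_tail[OF D \<sigma>, of "\<sigma> * sqrt (2 * t)"] \<sigma> t
    by (simp add: power_mult_distrib)
next
  assume [measurable]: "X \<in> borel_measurable M" and null: "AE \<omega> in M. X \<omega> = 0"
  have "0 \<le> sqrt (variance X) * sqrt (2 * t)"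
    using t by (intro mult_nonneg_nonneg real_sqrt_ge_zero Bochner_Integration.integral_nonneg) auto
  then have "prob {\<omega> \<in> space M. sqrt (variance X) * sqrt (2 * t) < \<bar>X \<omega>\<bar>} = prob {}"
    using null by (intro finite_measure_eq_AE) (auto simp del: measure_empty)
  then show ?thesis by simp
qed

section \<open>Quantiles and the multiplicity correction\<close>

text \<open>
  A \<open>LEAST\<close> over the reals means something only if the minimum is attained. The set of admissible \<open>z\<close> is
  nonempty since \<open>P(\<bar>X\<bar> > n)\<close> tends to 0, and contains its infimum \<open>z\<^sub>0\<close> since \<open>{\<bar>X\<bar> > z}\<close> increases
  to \<open>{\<bar>X\<bar> > z\<^sub>0}\<close> as \<open>z\<close> decreases to \<open>z\<^sub>0\<close>.
\<close>

lemma (in prob_space) least_tail_level: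
  fixes X :: "'a \<Rightarrow> real"
  assumes [measurable]: "X \<in> borel_measurable M" and c: "0 < c"
  defines "s \<equiv> LEAST z. 0 \<le> z \<and> prob {\<omega> \<in> space M. \<bar>X \<omega>\<bar> > z} \<le> c"
  shows "0 \<le> s" "prob {\<omega> \<in> space M. \<bar>X \<omega>\<bar> > s} \<le> c"
    "\<And>z. 0 \<le> z \<Longrightarrow> prob {\<omega> \<in> space M. \<bar>X \<omega>\<bar> > z} \<le> c \<Longrightarrow> s \<le> z"
proof -
  define G where "G z = {\<omega> \<in> space M. \<bar>X \<omega>\<bar> > z}" for z
  define S where "S = {z. 0 \<le> z \<and> prob (G z) \<le> c}"
  have G[measurable]: "G z \<in> sets M" for z
    unfolding G_def by measurable
  have "(\<lambda>n. prob (G (real n))) \<longlonglongrightarrow> prob (\<Inter>n. G (real n))"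
    by (intro finite_Lim_measure_decseq) (auto simp: decseq_def G_def)
  also have "(\<Inter>n. G (real n)) = {}"
  proof (intro equals0I)
    fix \<omega> assume "\<omega> \<in> (\<Inter>n. G (real n))"
    then have "real n < \<bar>X \<omega>\<bar>" for n
      by (simp add: G_def)
    then show False
      using reals_Archimedean2[of "\<bar>X \<omega>\<bar>"] less_asym by blast
  qed
  finally have "(\<lambda>n. prob (G (real n))) \<longlonglongrightarrow> 0"
    by simp
  then have "\<forall>\<^sub>F n in sequentially. prob (G (real n)) < c"
    using c by (rule order_tendstoD)
  then obtain n :: nat where "prob (G (real n)) < c"
    by (auto simp: eventually_sequentially)
  then have S: "S \<noteq> {}" "bdd_below S"
    by (auto simp: S_def intro!: exI[of _ "real n"] bdd_belowI[of _ 0])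
  have approx: "prob (G (Inf S + 1 / real (Suc n))) \<le> c" for n
  proof -
    have "Inf S < Inf S + 1 / real (Suc n)" by simp
    then obtain z where z: "z \<in> S" "z < Inf S + 1 / real (Suc n)"
      using cInf_lessD[OF S(1)] by blast
    then have "prob (G (Inf S + 1 / real (Suc n))) \<le> prob (G z)"
      by (intro finite_measure_mono) (auto simp: G_def)
    also have "\<dots> \<le> c" using z by (simp add: S_def)
    finally show ?thesis .
  qed
  have inc: "incseq (\<lambda>n. G (Inf S + 1 / real (Suc n)))"
  proof (rule incseq_SucI)
    fix n
    have "1 / real (Suc (Suc n)) \<le> 1 / real (Suc n)" by (simp add: field_simps)
    then show "G (Inf S + 1 / real (Suc n)) \<le> G (Inf S + 1 / real (Suc (Suc n)))"
      by (auto simp: G_def)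
  qed
  have un: "(\<Union>n. G (Inf S + 1 / real (Suc n))) = G (Inf S)"
  proof safe
    fix \<omega> n assume "\<omega> \<in> G (Inf S + 1 / real (Suc n))"
    moreover have "Inf S < Inf S + 1 / real (Suc n)" by simp
    ultimately show "\<omega> \<in> G (Inf S)"
      unfolding G_def by (blast intro: less_trans)
  next
    fix \<omega> assume w: "\<omega> \<in> G (Inf S)"
    then have "0 < \<bar>X \<omega>\<bar> - Inf S" by (simp add: G_def)
    then obtain n where "inverse (real (Suc n)) < \<bar>X \<omega>\<bar> - Inf S"
      using reals_Archimedean by blast
    then show "\<omega> \<in> (\<Union>n. G (Inf S + 1 / real (Suc n)))"
      using w by (auto simp: G_def inverse_eq_divide intro!: exI[of _ n])
  qed
  have "(\<lambda>n. prob (G (Inf S + 1 / real (Suc n)))) \<longlonglongrightarrow> prob (\<Union>n. G (Inf S + 1 / real (Suc n)))"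
    by (rule finite_Lim_measure_incseq[OF _ inc]) auto
  then have "prob (G (Inf S)) \<le> c"
    unfolding un using approx by (intro LIMSEQ_le_const2) auto
  moreover have "0 \<le> Inf S"
    using S by (intro cInf_greatest) (auto simp: S_def)
  ultimately have Inf_S: "Inf S \<in> S" by (simp add: S_def)
  have "s = (LEAST z. z \<in> S)"
    by (simp add: s_def S_def G_def)
  then have s: "s = Inf S"
    using Inf_S S cInf_lower by (auto intro!: Least_equality)
  show "0 \<le> s" "prob {\<omega> \<in> space M. \<bar>X \<omega>\<bar> > s} \<le> c"
    using Inf_S unfolding s by (auto simp: S_def G_def)
  show "s \<le> z" if "0 \<le> z" "prob {\<omega> \<in> space M. \<bar>X \<omega>\<bar> > z} \<le> c" for z
    unfolding s using that S by (intro cInf_lower) (auto simp: S_def G_def)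
qed

text \<open>
  The union bound gives \<open>exp (-x) \<le> card A * exp (-t)\<close>, once every \<open>P(\<bar>X\<^sub>i\<bar> \<ge> s\<^sub>i)\<close> is known to be at
  most \<open>exp (-t)\<close>. For a nondegenerate law this holds because there are no atoms. A degenerate \<open>X\<^sub>i\<close>
  would have \<open>s\<^sub>i = 0\<close>, hence \<open>{\<bar>X\<^sub>i\<bar> \<ge> s\<^sub>i}\<close> would be the whole space, against \<open>exp (-x) < 1\<close>.
\<close>

lemma (in prob_space) union_of_tails_level:
  fixes X :: "'i \<Rightarrow> 'a \<Rightarrow> real"
  assumes A: "finite A" "A \<noteq> {}" and gauss: "\<And>i. i \<in> A \<Longrightarrow> centered_gaussian M (X i)"
    and s: "\<And>i. i \<in> A \<Longrightarrow> s i = (LEAST z. 0 \<le> z \<and> prob {\<omega> \<in> space M. \<bar>X i \<omega>\<bar> > z} \<le> exp (- t))"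
    and x: "0 < x"
    and level: "prob (\<Union>i\<in>A. {\<omega> \<in> space M. \<bar>X i \<omega>\<bar> \<ge> s i}) = exp (- x)"
  shows "t \<le> x + ln (card A)"
proof -
  have rv[measurable]: "X i \<in> borel_measurable M" if "i \<in> A" for i
    using gauss[OF that] by (auto simp: centered_gaussian_def distributed_def)
  have sets: "{\<omega> \<in> space M. \<bar>X i \<omega>\<bar> \<ge> s i} \<in> sets M" if "i \<in> A" for i
    using rv[OF that] by measurable
  have each: "prob {\<omega> \<in> space M. \<bar>X i \<omega>\<bar> \<ge> s i} \<le> exp (- t)" if i: "i \<in> A" for i
    using gauss[OF i] unfolding centered_gaussian_def
  proof (elim disjE exE conjE)
    fix \<sigma> :: real assume "0 < \<sigma>" and D: "distributed M lborel (X i) (normal_density 0 \<sigma>)"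
    show ?thesis
      unfolding normal_abs_no_atom[OF D] s[OF i]
      by (rule least_tail_level(2)) (simp_all add: i rv)
  next
    assume null: "AE \<omega> in M. X i \<omega> = 0"
    have "prob {\<omega> \<in> space M. \<bar>X i \<omega>\<bar> > 0} = prob {}"
      using null rv[OF i] by (intro finite_measure_eq_AE) (auto simp del: measure_empty)
    then have "s i \<le> 0"
      unfolding s[OF i] by (intro least_tail_level(3)) (simp_all add: i rv)
    then have "space M \<subseteq> (\<Union>i\<in>A. {\<omega> \<in> space M. \<bar>X i \<omega>\<bar> \<ge> s i})"
      using i by (auto intro!: bexI[of _ i])
    then have "(\<Union>i\<in>A. {\<omega> \<in> space M. \<bar>X i \<omega>\<bar> \<ge> s i}) = space M"
      by blast
    then have "exp (- x) = 1"
      using level by (simp add: prob_space)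
    then show ?thesis using x by simp
  qed
  have "exp (- x) \<le> (\<Sum>i\<in>A. prob {\<omega> \<in> space M. \<bar>X i \<omega>\<bar> \<ge> s i})"
    unfolding level[symmetric] using A sets by (intro measure_subadditive_finite) auto
  also have "\<dots> \<le> card A * exp (- t)"
    using each sum_bounded_above[of A _ "exp (- t)"] by simp
  finally have "ln (exp (- x)) \<le> ln (card A * exp (- t))"
    using A by (subst ln_le_cancel_iff) (auto simp: card_gt_0_iff)
  then show ?thesis
    using A by (simp add: ln_mult card_gt_0_iff)
qed

section \<open>The selector on the favourable event\<close>

lemma functional_add: "functional A (y + z) = functional A y + functional A z"
  by (simp add: functional_def matrix_vector_right_distrib)

lemma functional_diff: "functional (A - B) y = functional A y - functional B y"
  by (simp add: functional_def matrix_vector_mult_diff_rdistrib)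

lemma functional_eq_sum: "functional A y = (\<Sum>i\<in>UNIV. A $ 1 $ i * y $ i)"
  by (simp add: functional_def matrix_vector_mult_def)

lemma payment_nonneg:
  assumes "finite Ms" "\<And>m. m \<in> M_minus Ms ms \<Longrightarrow> 0 \<le> zc ms m"
  shows "0 \<le> payment Ms Mc zc ms"
proof (cases "M_minus Ms ms - Mc = {}")
  case False
  then obtain m where m: "m \<in> M_minus Ms ms - Mc" by blast
  moreover have "finite (M_minus Ms ms)" using assms by (simp add: M_minus_def)
  ultimately show ?thesis
    using assms(2)[of m] False by (auto simp: payment_def intro!: Max_ge_iff[THEN iffD2])
qed (simp add: payment_def)

text \<open>
  Since \<open>ms\<close> is accepted, the selected index \<open>h\<close> satisfies \<open>h \<le> ms\<close>. If \<open>h < ms\<close>, then \<open>ms\<close> is among the larger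
  indices with which the accepted \<open>h\<close> has been compared, and \<open>zc ms h\<close> is one of the terms of the maximum
  defining the payment.
\<close>

lemma sma_selector_close:
  assumes Ms: "finite Ms" "ms \<in> Ms" and acc: "accepted K Ms zc y ms"
    and rej: "\<And>m. m \<in> Mc \<Longrightarrow> \<not> accepted K Ms zc y m"
    and nonneg: "\<And>m. m \<in> M_minus Ms ms \<Longrightarrow> 0 \<le> zc ms m"
  shows "\<bar>functional (K (sma_selector K Ms zc y)) y - functional (K ms) y\<bar> \<le> payment Ms Mc zc ms"
proof -
  define h where "h = sma_selector K Ms zc y"
  have h: "h \<in> Ms" "accepted K Ms zc y h" "h \<le> ms"
    using Min_in[of "{m0 \<in> Ms. accepted K Ms zc y m0}"] Min_le[of "{m0 \<in> Ms. accepted K Ms zc y m0}" ms]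
      Ms acc by (auto simp: h_def sma_selector_def)
  show ?thesis
  proof (cases "h = ms")
    case True
    then show ?thesis
      using payment_nonneg[OF Ms(1), of ms zc Mc] nonneg by (simp flip: h_def)
  next
    case False
    then have m: "h \<in> M_minus Ms ms - Mc"
      using h rej by (auto simp: M_minus_def)
    have "\<bar>functional (K h) y - functional (K ms) y\<bar> \<le> zc ms h"
      using h Ms False by (auto simp: accepted_def M_plus_def abs_minus_commute)
    also have "\<dots> \<le> payment Ms Mc zc ms"
      using m Ms by (auto simp: payment_def M_minus_def intro!: Max_ge)
    finally show ?thesis by (simp add: h_def)
  qed
qed

lemma accepted_event_sets:
  assumes "finite Ms" and [measurable]: "\<And>m. (\<lambda>\<omega>. functional (K m) (Y \<omega>)) \<in> borel_measurable M"
  shows "{\<omega> \<in> space M. accepted K Ms zc (Y \<omega>) m0} \<in> sets M"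
proof -
  have "{\<omega> \<in> space M. \<forall>m\<in>M_plus Ms m0. \<bar>functional (K m) (Y \<omega>) - functional (K m0) (Y \<omega>)\<bar> \<le> zc m m0} \<in> sets M"
    using assms by (intro sets.sets_Collect_finite_All) (auto simp: M_plus_def)
  then show ?thesis by (simp add: accepted_def)
qed

text \<open>
  The selector depends on \<open>\<omega>\<close> only through the set of accepted indices, which takes finitely many
  values; splitting according to this set leaves a fixed index in \<open>Q\<close>. Without measurability,
  \<open>measure\<close> would assign the value 0 to the event of interest.
\<close>

lemma sma_selector_event_sets:
  assumes Ms: "finite Ms" and Y: "\<And>m. (\<lambda>\<omega>. functional (K m) (Y \<omega>)) \<in> borel_measurable M"
    and Q: "\<And>m. {\<omega> \<in> space M. Q m \<omega>} \<in> sets M"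
  shows "{\<omega> \<in> space M. Q (sma_selector K Ms zc (Y \<omega>)) \<omega>} \<in> sets M"
proof -
  have pattern: "{\<omega> \<in> space M. \<forall>m0\<in>Ms. accepted K Ms zc (Y \<omega>) m0 \<longleftrightarrow> m0 \<in> S} \<in> sets M" for S
    using Ms accepted_event_sets[OF Ms Y]
    by (intro sets.sets_Collect_finite_All sets.sets_Collect) auto
  have "{\<omega> \<in> space M. \<exists>S\<in>Pow Ms.
      (\<forall>m0\<in>Ms. accepted K Ms zc (Y \<omega>) m0 \<longleftrightarrow> m0 \<in> S) \<and> Q (Min S) \<omega>} \<in> sets M"
    using Ms pattern Q by (intro sets.sets_Collect_finite_Ex sets.sets_Collect_conj) auto
  also have "{\<omega> \<in> space M. \<exists>S\<in>Pow Ms.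
      (\<forall>m0\<in>Ms. accepted K Ms zc (Y \<omega>) m0 \<longleftrightarrow> m0 \<in> S) \<and> Q (Min S) \<omega>}
      = {\<omega> \<in> space M. Q (sma_selector K Ms zc (Y \<omega>)) \<omega>}"
  proof (intro Collect_cong conj_cong refl iffI)
    fix \<omega>
    assume "\<exists>S\<in>Pow Ms. (\<forall>m0\<in>Ms. accepted K Ms zc (Y \<omega>) m0 \<longleftrightarrow> m0 \<in> S) \<and> Q (Min S) \<omega>"
    then obtain S where S: "S \<subseteq> Ms" "\<forall>m0\<in>Ms. accepted K Ms zc (Y \<omega>) m0 \<longleftrightarrow> m0 \<in> S" "Q (Min S) \<omega>"
      by blast
    then have "{m0 \<in> Ms. accepted K Ms zc (Y \<omega>) m0} = S" by blast
    then show "Q (sma_selector K Ms zc (Y \<omega>)) \<omega>" using S by (simp add: sma_selector_def)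
  next
    fix \<omega>
    assume "Q (sma_selector K Ms zc (Y \<omega>)) \<omega>"
    then show "\<exists>S\<in>Pow Ms. (\<forall>m0\<in>Ms. accepted K Ms zc (Y \<omega>) m0 \<longleftrightarrow> m0 \<in> S) \<and> Q (Min S) \<omega>"
      by (intro bexI[of _ "{m0 \<in> Ms. accepted K Ms zc (Y \<omega>) m0}"]) (auto simp: sma_selector_def)
  qed
  finally show ?thesis .
qed

section \<open>Critical values and risk of the selected estimator\<close>

theorem theorem2p6:
  fixes P :: "'a measure"
    and eps :: "'a \<Rightarrow> real ^ 'n"
    and f :: "real ^ 'n"
    and Kt :: "real ^ 'n ^ 1"
    and K :: "real \<Rightarrow> real ^ 'n ^ 1"
    and Ms Mc :: "real set"
    and x \<beta> xs ms :: real
    and q :: "real \<Rightarrow> real"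
    and zc :: "real \<Rightarrow> real \<Rightarrow> real"
  assumes P: "prob_space P"
    and indep: "prob_space.indep_vars P (\<lambda>_. borel) (\<lambda>i \<omega>. eps \<omega> $ i) UNIV"
    and gaussian: "\<forall>i. centered_gaussian P (\<lambda>\<omega>. eps \<omega> $ i)"
    and Ms: "finite Ms" "Ms \<noteq> {}" "\<forall>m \<in> Ms. 0 < m"
    and rank_Kt: "rank Kt = 1"
    and rank_K: "\<forall>m \<in> Ms. rank (K m) = 1"
    and ordering: "\<forall>m0 \<in> Ms. \<forall>m \<in> M_plus Ms m0. est_sd P eps f K m0 \<le> est_sd P eps f K m"
    and x: "0 < x"
    and \<beta>: "0 \<le> \<beta>"
    and q: "multiplicity_correction P eps K Ms x q"
    and zc: "zc = critical_value P eps K x \<beta> q"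
    and ms: "ms = oracle_index P eps f K Ms \<beta>"
    and xs: "xs = x + ln (real (card Mc))"
    and Mc: "Mc \<subseteq> M_minus Ms ms"
      "\<forall>m \<in> Mc. \<bar>bias f K ms m\<bar> > zc ms m + tail_fun P eps K ms m xs"
  shows "(\<forall>m0 \<in> Ms. \<forall>m \<in> M_plus Ms m0.
            zc m m0 \<le> diff_sd P eps K m m0 * (\<beta> + sqrt (2 * x + 2 * ln (real (card Ms))))) \<and>
         measure P {\<omega> \<in> space P.
            \<bar>functional (K (sma_selector K Ms zc (f + eps \<omega>))) (f + eps \<omega>) - functional Kt f\<bar>
              \<le> \<bar>functional (K ms) (f + eps \<omega>) - functional Kt f\<bar> + payment Ms Mc zc ms}
           \<ge> 1 - 2 * exp (- x) \<and>
         (increments_dominated P eps f K (M_minus Ms ms - Mc) ms \<longrightarrow>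
            payment Ms Mc zc ms \<le> est_sd P eps f K ms * (\<beta> + sqrt (2 * x + 2 * ln (real (card Ms)))))"
proof -
  interpret prob_space P by (rule P)
  let ?L = "sqrt (2 * x + 2 * ln (real (card Ms)))"
  let ?T = "tail_fun P eps K"
  have comp: "(\<lambda>\<omega>. eps \<omega> $ i) \<in> borel_measurable P" for i
    using gaussian by (auto simp: centered_gaussian_def distributed_def)
  have est[measurable]: "(\<lambda>\<omega>. functional A (f + eps \<omega>)) \<in> borel_measurable P" for A
    unfolding functional_eq_sum using comp by simp
  have xi_gauss: "centered_gaussian P (xi eps K m m0)" for m m0
    unfolding xi_def[abs_def] functional_eq_sum
    using gaussian by (intro centered_gaussian_linear_combination[OF _ indep]) auto
  then have xi_rv[measurable]: "xi eps K m m0 \<in> borel_measurable P" for m m0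
    by (auto simp: centered_gaussian_def distributed_def)
  note tail = least_tail_level[OF xi_rv, of "exp (- t)" for t, folded tail_fun_def, simplified]
  have incr: "functional (K m) (f + eps \<omega>) - functional (K m0) (f + eps \<omega>)
      = bias f K m m0 + xi eps K m m0 \<omega>" for m m0 \<omega>
    by (simp add: bias_def xi_def functional_diff functional_add)
  have card: "1 \<le> real (card Ms)"
    using Ms by (simp add: Suc_le_eq card_gt_0_iff)
  have sd: "0 \<le> diff_sd P eps K m m0" for m m0
    unfolding diff_sd_def diff_var_def
    by (intro real_sqrt_ge_zero Bochner_Integration.integral_nonneg) auto
  have zc_eq: "zc m m0 = ?T m m0 (x + q m0) + \<beta> * diff_sd P eps K m m0" for m m0
    by (simp add: zc critical_value_def diff_sd_def)
  have zc_nonneg: "0 \<le> zc m m0" for m m0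
    using tail(1) sd \<beta> by (simp add: zc_eq)

  have zc_le: "zc m m0 \<le> diff_sd P eps K m m0 * (\<beta> + ?L)"
    if m0: "m0 \<in> Ms" and m: "m \<in> M_plus Ms m0" for m m0
  proof -
    have M_plus: "finite (M_plus Ms m0)" "M_plus Ms m0 \<noteq> {}" "M_plus Ms m0 \<subseteq> Ms"
      using Ms m by (auto simp: M_plus_def)
    have "x + q m0 \<le> x + ln (card (M_plus Ms m0))"
      using q m0 M_plus(2)
      by (intro union_of_tails_level[where X = "\<lambda>m. xi eps K m m0" and s = "\<lambda>m. ?T m m0 (x + q m0)",
            OF M_plus(1,2) xi_gauss tail_fun_def x])
         (auto simp: multiplicity_correction_def)
    also have "\<dots> \<le> x + ln (card Ms)"
      using M_plus Ms card_mono[OF Ms(1) M_plus(3)] by (auto simp: card_gt_0_iff)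
    \<comment> \<open>A larger level permits less mass in the tail, so a threshold adequate for the level
      \<open>x + ln (card Ms)\<close> is adequate for \<open>x + q m0\<close>.\<close>
    finally have "exp (- (x + ln (card Ms))) \<le> exp (- (x + q m0))"
      by simp
    moreover have "prob {\<omega> \<in> space P. \<bar>xi eps K m m0 \<omega>\<bar> > diff_sd P eps K m m0 * ?L}
        \<le> exp (- (x + ln (card Ms)))"
      using centered_gaussian_tail[OF xi_gauss, of "x + ln (card Ms)" m m0] x card
      by (simp add: diff_sd_def diff_var_def ring_distribs)
    ultimately have "prob {\<omega> \<in> space P. \<bar>xi eps K m m0 \<omega>\<bar> > diff_sd P eps K m m0 * ?L}
        \<le> exp (- (x + q m0))"
      by (rule order_trans[rotated])
    moreover have "0 \<le> diff_sd P eps K m m0 * ?L"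
      using sd x card by simp
    ultimately have "?T m m0 (x + q m0) \<le> diff_sd P eps K m m0 * ?L"
      by (rule tail(3)[rotated])
    then show ?thesis
      by (simp add: zc_eq algebra_simps)
  qed

  define admissible where "admissible = {m0 \<in> Ms. \<forall>m \<in> M_plus Ms m0. \<bar>bias f K m m0\<bar>\<^sup>2 \<le> \<beta>\<^sup>2 * diff_var P eps K m m0}"
  \<comment> \<open>No index is larger than the maximum, so the set over which \<open>ms\<close> is the minimum is nonempty.\<close>
  have "Max Ms \<in> admissible"
    using Ms by (auto simp: admissible_def M_plus_def not_less[symmetric] dest: Max_ge)
  moreover have "finite admissible"
    using Ms by (simp add: admissible_def)
  moreover have "ms = Min admissible"
    by (simp add: ms oracle_index_def admissible_def)
  ultimately have "ms \<in> admissible"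
    by (metis Min_in empty_iff)
  then have ms_in: "ms \<in> Ms"
    and ms_bias: "\<And>m. m \<in> M_plus Ms ms \<Longrightarrow> \<bar>bias f K m ms\<bar>\<^sup>2 \<le> \<beta>\<^sup>2 * diff_var P eps K m ms"
    by (auto simp: admissible_def)
  have bias_le: "\<bar>bias f K m ms\<bar> \<le> \<beta> * diff_sd P eps K m ms" if "m \<in> M_plus Ms ms" for m
    using real_sqrt_le_mono[OF ms_bias[OF that]] \<beta> by (simp add: diff_sd_def real_sqrt_mult)

  \<comment> \<open>Outside \<open>B1\<close> the index \<open>ms\<close> is accepted; outside \<open>B2\<close> every index in \<open>Mc\<close> is rejected.\<close>
  define B1 where "B1 = (\<Union>m\<in>M_plus Ms ms. {\<omega> \<in> space P. \<bar>xi eps K m ms \<omega>\<bar> \<ge> ?T m ms (x + q ms)})"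
  define B2 where "B2 = (\<Union>m\<in>Mc. {\<omega> \<in> space P. \<bar>xi eps K ms m \<omega>\<bar> > ?T ms m xs})"
  define E where "E = {\<omega> \<in> space P.
            \<bar>functional (K (sma_selector K Ms zc (f + eps \<omega>))) (f + eps \<omega>) - functional Kt f\<bar>
              \<le> \<bar>functional (K ms) (f + eps \<omega>) - functional Kt f\<bar> + payment Ms Mc zc ms}"
  have fin: "finite (M_plus Ms ms)" "finite Mc"
    using Ms Mc(1) by (auto simp: M_plus_def M_minus_def intro: finite_subset)
  have B1_sets: "B1 \<in> sets P" and B2_sets: "B2 \<in> sets P"
    unfolding B1_def B2_def using fin by (intro sets.finite_UN; measurable)+
  have E_sets: "E \<in> sets P"
    unfolding E_def
  proof (rule sma_selector_event_sets[OF Ms(1) est])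
    show "{\<omega> \<in> space P. \<bar>functional (K m) (f + eps \<omega>) - functional Kt f\<bar>
        \<le> \<bar>functional (K ms) (f + eps \<omega>) - functional Kt f\<bar> + payment Ms Mc zc ms} \<in> sets P" for m
      by measurable
  qed
  have B1: "prob B1 \<le> exp (- x)"
    using q ms_in by (cases "M_plus Ms ms = {}") (auto simp: B1_def multiplicity_correction_def)
  have B2: "prob B2 \<le> exp (- x)"
  proof (cases "Mc = {}")
    case False
    have "prob B2 \<le> (\<Sum>m\<in>Mc. prob {\<omega> \<in> space P. \<bar>xi eps K ms m \<omega>\<bar> > ?T ms m xs})"
      unfolding B2_def using fin by (intro measure_subadditive_finite) auto
    also have "\<dots> \<le> (\<Sum>m\<in>Mc. exp (- xs))"
      by (intro sum_mono tail(2))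
    also have "\<dots> = exp (- x)"
      using False fin by (simp add: xs exp_diff card_gt_0_iff exp_minus exp_add)
    finally show ?thesis .
  qed (simp add: B2_def)

  have good: "\<omega> \<in> E" if "\<omega> \<in> space P - (B1 \<union> B2)" for \<omega>
  proof -
    let ?y = "f + eps \<omega>"
    have "accepted K Ms zc ?y ms"
      unfolding accepted_def
    proof
      fix m assume m: "m \<in> M_plus Ms ms"
      then have "\<bar>xi eps K m ms \<omega>\<bar> < ?T m ms (x + q ms)"
        using that by (force simp: B1_def)
      then show "\<bar>functional (K m) ?y - functional (K ms) ?y\<bar> \<le> zc m ms"
        using bias_le[OF m] by (simp add: incr zc_eq)
    qed
    moreover have "\<not> accepted K Ms zc ?y m" if m: "m \<in> Mc" for m
    proof -
      have "\<bar>xi eps K ms m \<omega>\<bar> \<le> ?T ms m xs"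
        using m \<open>\<omega> \<in> space P - (B1 \<union> B2)\<close> by (force simp: B2_def)
      then have "zc ms m < \<bar>functional (K ms) ?y - functional (K m) ?y\<bar>"
        using Mc(2) m unfolding incr by fastforce
      moreover have "ms \<in> M_plus Ms m"
        using m Mc(1) ms_in by (auto simp: M_plus_def M_minus_def)
      ultimately show ?thesis
        by (force simp: accepted_def)
    qed
    ultimately have "\<bar>functional (K (sma_selector K Ms zc ?y)) ?y - functional (K ms) ?y\<bar>
        \<le> payment Ms Mc zc ms"
      using zc_nonneg by (intro sma_selector_close[OF Ms(1) ms_in]) auto
    then show ?thesis
      using that by (auto simp: E_def)
  qed
  have "1 - prob E = prob (space P - E)"
    by (simp add: prob_compl E_sets)
  also have "\<dots> \<le> prob (B1 \<union> B2)"
    using good B1_sets B2_sets by (intro finite_measure_mono) auto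
  also have "\<dots> \<le> prob B1 + prob B2"
    using B1_sets B2_sets by (intro measure_subadditive) auto
  finally have prob_E: "1 - 2 * exp (- x) \<le> prob E"
    using B1 B2 by simp

  have pay: "payment Ms Mc zc ms \<le> est_sd P eps f K ms * (\<beta> + ?L)"
    if dom: "increments_dominated P eps f K (M_minus Ms ms - Mc) ms"
  proof -
    have L: "0 \<le> \<beta> + ?L" using \<beta> x card by simp
    have each: "zc ms m \<le> est_sd P eps f K ms * (\<beta> + ?L)" if m: "m \<in> M_minus Ms ms - Mc" for m
    proof -
      have "zc ms m \<le> diff_sd P eps K ms m * (\<beta> + ?L)"
        using m ms_in by (intro zc_le) (auto simp: M_plus_def M_minus_def)
      also have "\<dots> \<le> est_sd P eps f K ms * (\<beta> + ?L)"
        using dom m L by (intro mult_right_mono) (auto simp: increments_dominated_def)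
      finally show ?thesis .
    qed
    have "0 \<le> est_sd P eps f K ms"
      unfolding est_sd_def by (intro real_sqrt_ge_zero Bochner_Integration.integral_nonneg) auto
    moreover have "finite (M_minus Ms ms)" using Ms by (simp add: M_minus_def)
    ultimately show ?thesis
      using each L by (auto simp: payment_def)
  qed
  show ?thesis
    using zc_le prob_E pay by (auto simp: E_def)
qed

end
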